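(* Let $\varepsilon_f,\varepsilon_b>0$, let $\mathcal{R}_b$ be a replacement $\varepsilon_b$-DP local randomizer, let $\mathcal{R}_f$ be a replacement $\varepsilon_f$-DP local randomizer whose inputs are the outputs of $\mathcal{R}_b$, let $\tau\ge1$ be an integer, and let $J\subseteq[\tau]=\{1,\dots,\tau\}$ be a set of indices of size $t$. Consider the algorithm $\mathcal{M}_J$ that, on input $x$, computes $x'\leftarrow\mathcal{R}_b(x)$, then computes $y_i\leftarrow\mathcal{R}_f(x')$ for $i\in[\tau]$ using independent randomness for each $i$, and outputs $y_J=(y_i)_{i\in J}$. Then $\mathcal{M}_J$ is a replacement $\varepsilon$-DP local randomizer for $$\varepsilon=\ln\left(\frac{e^{\varepsilon_b+t\varepsilon_f}+1}{e^{\varepsilon_b}+e^{t\varepsilon_f}}\right)\le\min\{\varepsilon_b,\,t\varepsilon_f\}.$$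
   Context: A randomized algorithm $\mathcal{R}\colon\mathcal{D}\to\mathcal{S}$ is a replacement $\varepsilon$-DP local randomizer if for all $S\subseteq\mathcal{S}$ and all $x,x'\in\mathcal{D}$: $\Pr[\mathcal{R}(x)\in S]\le e^{\varepsilon}\Pr[\mathcal{R}(x')\in S]$. *)

theory Defs
  imports "HOL-Probability.Probability"
begin

text \<open>
  A randomized algorithm from \<open>D\<close> to \<open>S\<close> is a Markov kernel between measurable spaces: \<open>R x\<close> is
  the distribution of the output on input \<open>x\<close>. Discrete domains and ranges are the instances where
  \<open>D\<close> and \<open>S\<close> are of the form \<open>count_space A\<close>; then every subset of \<open>A\<close> is an event.
\<close>

definition replacement_DP_local_randomizer ::
  "'a measure \<Rightarrow> 'b measure \<Rightarrow> real \<Rightarrow> ('a \<Rightarrow> 'b measure) \<Rightarrow> bool" where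
  "replacement_DP_local_randomizer D S \<epsilon> R \<longleftrightarrow>
     R \<in> measurable D (prob_algebra S) \<and>
     (\<forall>A\<in>sets S. \<forall>x\<in>space D. \<forall>x'\<in>space D.
        measure (R x) A \<le> exp \<epsilon> * measure (R x') A)"

text \<open>
  The product measure \<open>PiM {1..\<tau>} (\<lambda>_. R\<^sub>f x')\<close> is the joint distribution of
  \<open>y\<^sub>1, \<dots>, y\<^sub>\<tau>\<close>, which are independent given \<open>x'\<close> but share the same \<open>x'\<close>;
  \<open>Y\<close> is the output space of \<open>R\<^sub>f\<close>.
\<close>

definition M_alg ::
  "('a \<Rightarrow> 'b measure) \<Rightarrow> ('b \<Rightarrow> 'c measure) \<Rightarrow> 'c measure \<Rightarrow> nat \<Rightarrow> nat set \<Rightarrow>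
   'a \<Rightarrow> (nat \<Rightarrow> 'c) measure" where
  "M_alg R\<^sub>b R\<^sub>f Y \<tau> J x =
     bind (R\<^sub>b x) (\<lambda>x'.
       distr (PiM {1..\<tau>} (\<lambda>_. R\<^sub>f x')) (PiM J (\<lambda>_. Y)) (\<lambda>y. restrict y J))"

end

theory Submission
  imports Defs
begin

text \<open>
  For fixed \<open>x'\<close> the tuple \<open>y\<^sub>J\<close> has the product law of \<open>t\<close> copies of \<open>R\<^sub>f x'\<close>, so an event \<open>A\<close> has
  probability \<open>f x'\<close> with \<open>m \<le> f \<le> exp (t * \<epsilon>\<^sub>f) * m\<close>, where \<open>m = inf f\<close>. Let \<open>p\<close>, \<open>q\<close> be the means
  of \<open>f\<close> under \<open>R\<^sub>b\<close> for two inputs. Integrating the nonnegative functions \<open>f - m\<close> and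
  \<open>exp (t * \<epsilon>\<^sub>f) * m - f\<close> against the two laws, which dominate each other up to \<open>exp \<epsilon>\<^sub>b\<close>, gives two
  linear inequalities in \<open>p\<close>, \<open>q\<close>, \<open>m\<close>; eliminating \<open>m\<close> yields the claimed ratio.
\<close>

section \<open>Domination of measures up to a factor, and its behaviour under products\<close>

text \<open>The hypothesis is exactly \<open>M \<le> scale_measure c N\<close> in the order on
  measures, and the integral is monotone in that order.\<close>

lemma nn_integral_le_cmult_of_emeasure_le:
  assumes "sets M = sets N" "\<And>A. A \<in> sets N \<Longrightarrow> emeasure M A \<le> c * emeasure N A"
    and "f \<in> borel_measurable N"
  shows "(\<integral>\<^sup>+x. f x \<partial>M) \<le> c * (\<integral>\<^sup>+x. f x \<partial>N)"
proof -
  have "M \<le> scale_measure c N"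
    using assms by (subst le_measure) auto
  then have "(\<integral>\<^sup>+x. f x \<partial>M) \<le> (\<integral>\<^sup>+x. f x \<partial>scale_measure c N)"
    using assms by (intro nn_integral_mono_measure) auto
  then show ?thesis
    using assms by (simp add: nn_integral_scale_measure)
qed

text \<open>Each coordinate costs one factor \<open>c\<close>: Fubini splits off a coordinate, and
  induction handles the rest. Functions rather than events are needed, since the inner integral is
  no longer an indicator.\<close>

lemma nn_integral_PiM_le_power:
  assumes "prob_space M" "prob_space N" and sets_eq: "sets M = sets N"
    and le: "\<And>A. A \<in> sets N \<Longrightarrow> emeasure M A \<le> c * emeasure N A"
    and "finite I" "f \<in> borel_measurable (PiM I (\<lambda>_. N))"
  shows "(\<integral>\<^sup>+x. f x \<partial>PiM I (\<lambda>_. M)) \<le> c ^ card I * (\<integral>\<^sup>+x. f x \<partial>PiM I (\<lambda>_. N))"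
proof -
  interpret M: prob_space M by fact
  interpret N: prob_space N by fact
  interpret PM: product_sigma_finite "\<lambda>_. M"
    by (simp add: product_sigma_finite_def M.sigma_finite_measure_axioms)
  interpret PN: product_sigma_finite "\<lambda>_. N"
    by (simp add: product_sigma_finite_def N.sigma_finite_measure_axioms)
  have sets_PiM_eq: "sets (PiM I (\<lambda>_. M)) = sets (PiM I (\<lambda>_. N))" for I :: "'b set"
    using sets_eq by (intro sets_PiM_cong) auto
  show ?thesis
    using assms(5,6)
  proof (induction I arbitrary: f rule: finite_induct)
    case empty
    then show ?case
      by (simp add: PM.nn_integral_empty PN.nn_integral_empty)
  next
    case (insert i I)
    note f [measurable] = insert.prems
    have fM: "f \<in> borel_measurable (PiM (insert i I) (\<lambda>_. M))"
      using f by (simp cong: measurable_cong_sets add: sets_PiM_eq)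
    interpret FN: finite_product_sigma_finite "\<lambda>_. N" I
      by standard fact
    have space_eq: "space M = space N"
      by (rule sets_eq_imp_space_eq[OF sets_eq])
    have upd: "(\<lambda>(y, x). x(i := y)) \<in> N \<Otimes>\<^sub>M PiM I (\<lambda>_. N) \<rightarrow>\<^sub>M PiM (insert i I) (\<lambda>_. N)"
      by measurable
    have f2: "(\<lambda>(y, x). f (x(i := y))) \<in> borel_measurable (N \<Otimes>\<^sub>M PiM I (\<lambda>_. N))"
      using measurable_comp[OF upd f] by (simp add: comp_def case_prod_beta)
    have inner: "(\<lambda>y. \<integral>\<^sup>+ x. f (x(i := y)) \<partial>PiM I (\<lambda>_. N)) \<in> borel_measurable N"
      using sigma_finite_measure.borel_measurable_nn_integral_fst[OF FN.sigma_finite_measure_axioms f2]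
      by simp
    have "(\<integral>\<^sup>+x. f x \<partial>PiM (insert i I) (\<lambda>_. M))
      = (\<integral>\<^sup>+ y. (\<integral>\<^sup>+ x. f (x(i := y)) \<partial>PiM I (\<lambda>_. M)) \<partial>M)"
      by (rule PM.product_nn_integral_insert_rev[OF insert.hyps fM])
    \<comment> \<open>The inner measure is exchanged first, for each fixed \<open>y\<close>; the
      outer one is still \<open>M\<close> and is exchanged in the next step.\<close>
    also have "\<dots> \<le> (\<integral>\<^sup>+ y. c ^ card I * (\<integral>\<^sup>+ x. f (x(i := y)) \<partial>PiM I (\<lambda>_. N)) \<partial>M)"
    proof (rule nn_integral_mono)
      fix y assume "y \<in> space M"
      then have "y \<in> space N" by (simp add: space_eq)
      then have "(\<lambda>x. f (x(i := y))) \<in> borel_measurable (PiM I (\<lambda>_. N))"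
        using measurable_Pair2[OF f2] by simp
      then show "(\<integral>\<^sup>+ x. f (x(i := y)) \<partial>PiM I (\<lambda>_. M))
        \<le> c ^ card I * (\<integral>\<^sup>+ x. f (x(i := y)) \<partial>PiM I (\<lambda>_. N))"
        by (rule insert.IH)
    qed
    also have "\<dots> \<le> c * (\<integral>\<^sup>+ y. c ^ card I * (\<integral>\<^sup>+ x. f (x(i := y)) \<partial>PiM I (\<lambda>_. N)) \<partial>N)"
      using inner by (intro nn_integral_le_cmult_of_emeasure_le[OF sets_eq le]) auto
    also have "\<dots> = c * (c ^ card I * (\<integral>\<^sup>+ y. (\<integral>\<^sup>+ x. f (x(i := y)) \<partial>PiM I (\<lambda>_. N)) \<partial>N))"
      using inner by (subst nn_integral_cmult) auto
    also have "\<dots> = c ^ card (insert i I) * (\<integral>\<^sup>+x. f x \<partial>PiM (insert i I) (\<lambda>_. N))"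
      unfolding PN.product_nn_integral_insert_rev[OF insert.hyps f]
      using insert.hyps by (simp add: mult.assoc)
    finally show ?case .
  qed
qed

text \<open>Measurability of a kernel can be tested on an intersection-stable generator. On boxes
  the product measure is a finite product of evaluations of \<open>K\<close>, each measurable in
  \<open>x\<close>.\<close>

lemma measurable_PiM_prob_algebra:
  assumes K: "K \<in> X \<rightarrow>\<^sub>M prob_algebra Y" and "finite I"
  shows "(\<lambda>x. PiM I (\<lambda>_. K x)) \<in> X \<rightarrow>\<^sub>M prob_algebra (PiM I (\<lambda>_. Y))"
proof (rule measurable_prob_algebra_generated[OF sets_PiM Int_stable_prod_algebra
      prod_algebra_sets_into_space])
  have Kx: "prob_space (K x)" "sets (K x) = sets Y" if "x \<in> space X" for x
    using measurable_space[OF K that] by (auto simp: space_prob_algebra)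
  fix x assume x: "x \<in> space X"
  show "prob_space (PiM I (\<lambda>_. K x))"
    using Kx x by (intro prob_space_PiM) auto
  show "sets (PiM I (\<lambda>_. K x)) = sets (PiM I (\<lambda>_. Y))"
    using Kx x by (intro sets_PiM_cong) auto
next
  have Kx: "prob_space (K x)" "sets (K x) = sets Y" if "x \<in> space X" for x
    using measurable_space[OF K that] by (auto simp: space_prob_algebra)
  fix A assume "A \<in> prod_algebra I (\<lambda>_. Y)"
  then obtain E where A: "A = Pi\<^sub>E I E" and E: "E \<in> (\<Pi> i\<in>I. sets Y)"
    by (rule prod_algebraE_all)
  have "emeasure (PiM I (\<lambda>_. K x)) A = (\<Prod>i\<in>I. emeasure (K x) (E i))" if x: "x \<in> space X" for x
  proof -
    interpret prob_space "K x" using Kx x by auto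
    interpret product_sigma_finite "\<lambda>_. K x"
      by (simp add: product_sigma_finite_def sigma_finite_measure_axioms)
    show ?thesis
      using E Kx(2)[OF x] \<open>finite I\<close> unfolding A by (intro emeasure_PiM) auto
  qed
  moreover have "(\<lambda>x. \<Prod>i\<in>I. emeasure (K x) (E i)) \<in> borel_measurable X"
    using E by (intro borel_measurable_prod_ennreal
        measurable_emeasure_kernel[OF measurable_prob_algebraD[OF K]]) auto
  ultimately show "(\<lambda>x. emeasure (PiM I (\<lambda>_. K x)) A) \<in> borel_measurable X"
    by (simp cong: measurable_cong)
qed

lemma emeasure_le_if_replacement_DP:
  assumes "replacement_DP_local_randomizer D S \<epsilon> R" "A \<in> sets S" "x \<in> space D" "x' \<in> space D"
  shows "emeasure (R x) A \<le> ennreal (exp \<epsilon>) * emeasure (R x') A"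
proof -
  have R: "R \<in> D \<rightarrow>\<^sub>M prob_algebra S" and le: "measure (R x) A \<le> exp \<epsilon> * measure (R x') A"
    using assms by (auto simp: replacement_DP_local_randomizer_def)
  interpret x: prob_space "R x"
    using measurable_space[OF R] assms by (auto simp: space_prob_algebra)
  interpret x': prob_space "R x'"
    using measurable_space[OF R] assms by (auto simp: space_prob_algebra)
  show ?thesis
    using le by (simp add: x.emeasure_eq_measure x'.emeasure_eq_measure flip: ennreal_mult)
qed

text \<open>Independent repetitions add up their privacy losses: the factor
  \<open>exp \<epsilon>\<close> of one coordinate is raised to the power
  \<open>card I\<close>.\<close>

lemma replacement_DP_PiM:
  assumes R: "replacement_DP_local_randomizer X Y \<epsilon> R" and "finite I"
  shows "replacement_DP_local_randomizer X (PiM I (\<lambda>_. Y)) (real (card I) * \<epsilon>)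
           (\<lambda>x. PiM I (\<lambda>_. R x))"
  unfolding replacement_DP_local_randomizer_def
proof (intro conjI ballI)
  have K: "R \<in> X \<rightarrow>\<^sub>M prob_algebra Y"
    using R by (simp add: replacement_DP_local_randomizer_def)
  show KP: "(\<lambda>x. PiM I (\<lambda>_. R x)) \<in> X \<rightarrow>\<^sub>M prob_algebra (PiM I (\<lambda>_. Y))"
    by (rule measurable_PiM_prob_algebra[OF K \<open>finite I\<close>])
  fix A x x' assume A: "A \<in> sets (PiM I (\<lambda>_. Y))" and x: "x \<in> space X" "x' \<in> space X"
  have Kx: "prob_space (R x)" "sets (R x) = sets Y" if "x \<in> space X" for x
    using measurable_space[OF K that] by (auto simp: space_prob_algebra)
  have Px: "prob_space (PiM I (\<lambda>_. R x))" "sets (PiM I (\<lambda>_. R x)) = sets (PiM I (\<lambda>_. Y))"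
    if "x \<in> space X" for x
    using measurable_space[OF KP that] by (auto simp: space_prob_algebra)
  interpret x: prob_space "PiM I (\<lambda>_. R x)" by (rule Px) fact
  interpret x': prob_space "PiM I (\<lambda>_. R x')" by (rule Px) fact
  have "(\<integral>\<^sup>+y. indicator A y \<partial>PiM I (\<lambda>_. R x))
    \<le> ennreal (exp \<epsilon>) ^ card I * (\<integral>\<^sup>+y. indicator A y \<partial>PiM I (\<lambda>_. R x'))"
    using x A Kx Px \<open>finite I\<close>
    by (intro nn_integral_PiM_le_power emeasure_le_if_replacement_DP[OF R]
        borel_measurable_indicator) (auto cong: sets_PiM_cong)
  then have "emeasure (PiM I (\<lambda>_. R x)) A
    \<le> ennreal (exp (real (card I) * \<epsilon>)) * emeasure (PiM I (\<lambda>_. R x')) A"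
    using x A Px by (simp add: ennreal_power exp_of_nat_mult)
  then show "measure (PiM I (\<lambda>_. R x)) A
    \<le> exp (real (card I) * \<epsilon>) * measure (PiM I (\<lambda>_. R x')) A"
    by (simp add: x.emeasure_eq_measure x'.emeasure_eq_measure flip: ennreal_mult)
qed

section \<open>Composition of two private kernels\<close>

text \<open>Extends the privacy inequality from events to bounded nonnegative functions. The bound
  \<open>B\<close> gives integrability, so that the real integral agrees with the nonnegative
  one.\<close>

lemma integral_le_if_replacement_DP:
  fixes g :: "'b \<Rightarrow> real"
  assumes R: "replacement_DP_local_randomizer D X \<epsilon> R" and x: "x \<in> space D" "x' \<in> space D"
    and g: "g \<in> borel_measurable X" "\<And>z. z \<in> space X \<Longrightarrow> 0 \<le> g z" "\<And>z. z \<in> space X \<Longrightarrow> g z \<le> B"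
  shows "(\<integral>z. g z \<partial>R x) \<le> exp \<epsilon> * (\<integral>z. g z \<partial>R x')"
proof -
  have K: "R \<in> D \<rightarrow>\<^sub>M prob_algebra X"
    using R by (simp add: replacement_DP_local_randomizer_def)
  have Rx: "prob_space (R x)" "sets (R x) = sets X" "space (R x) = space X" if "x \<in> space D" for x
    using measurable_space[OF K that] by (auto simp: space_prob_algebra dest: sets_eq_imp_space_eq)
  have int: "(\<integral>\<^sup>+z. ennreal (g z) \<partial>R x) = ennreal (\<integral>z. g z \<partial>R x)" "0 \<le> (\<integral>z. g z \<partial>R x)"
    if "x \<in> space D" for x
  proof -
    interpret prob_space "R x" by (rule Rx) fact
    have "g \<in> borel_measurable (R x)"
      using g(1) Rx(2)[OF that] by (simp cong: measurable_cong_sets)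
    then have "integrable (R x) g"
      using g Rx(3)[OF that] by (intro integrable_const_bound[where B = B]) auto
    then show "(\<integral>\<^sup>+z. ennreal (g z) \<partial>R x) = ennreal (\<integral>z. g z \<partial>R x)"
      using g Rx(3)[OF that] by (intro nn_integral_eq_integral) auto
    show "0 \<le> (\<integral>z. g z \<partial>R x)"
      using g Rx(3)[OF that] by (intro integral_nonneg_AE) auto
  qed
  have "g \<in> borel_measurable (R x')"
    using g(1) Rx(2)[OF x(2)] by (simp cong: measurable_cong_sets)
  then have "(\<integral>\<^sup>+z. ennreal (g z) \<partial>R x) \<le> ennreal (exp \<epsilon>) * (\<integral>\<^sup>+z. ennreal (g z) \<partial>R x')"
    using x Rx
    by (intro nn_integral_le_cmult_of_emeasure_le emeasure_le_if_replacement_DP[OF R]) auto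
  then show ?thesis
    using int x by (simp flip: ennreal_mult)
qed

text \<open>The ratio is that of two binary randomized responses in sequence:
  \<open>exp (b + a) + 1\<close> weighs the cases with no flip or two flips,
  \<open>exp b + exp a\<close> those with exactly one.\<close>

theorem replacement_DP_bind:
  assumes R: "replacement_DP_local_randomizer D X b R"
    and K: "replacement_DP_local_randomizer X S a K"
  shows "replacement_DP_local_randomizer D S (ln ((exp (b + a) + 1) / (exp b + exp a)))
           (\<lambda>x. bind (R x) K)"
  unfolding replacement_DP_local_randomizer_def
proof (intro conjI ballI)
  have mR: "R \<in> D \<rightarrow>\<^sub>M prob_algebra X" and mK: "K \<in> X \<rightarrow>\<^sub>M prob_algebra S"
    using R K by (simp_all add: replacement_DP_local_randomizer_def)
  then show "(\<lambda>x. bind (R x) K) \<in> D \<rightarrow>\<^sub>M prob_algebra S"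
    by (rule measurable_bind_prob_space)
  fix A x x' assume A: "A \<in> sets S" and x: "x \<in> space D" "x' \<in> space D"
  define f where "f z = measure (K z) A" for z
  define m where "m = (INF z\<in>space X. f z)"
  define p where "p x = (\<integral>z. f z \<partial>R x)" for x
  have Rx: "prob_space (R x)" "sets (R x) = sets X" "space (R x) = space X" if "x \<in> space D" for x
    using measurable_space[OF mR that] by (auto simp: space_prob_algebra dest: sets_eq_imp_space_eq)
  \<comment> \<open>Nonemptiness is what lets a common lower bound of \<open>f\<close> be compared
    with its infimum \<open>m\<close>.\<close>
  have ne: "space X \<noteq> {}"
    using prob_space.not_empty Rx(1,3) x(1) by metis
  have f_meas: "f \<in> borel_measurable X"
    unfolding f_def using measurable_prob_algebraD[OF mK] A
    by (rule measurable_measure_subprob_algebra[THEN measurable_compose_rev, rotated])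
  have f_range: "0 \<le> f z" "f z \<le> 1" if "z \<in> space X" for z
    using measurable_space[OF mK that]
    by (auto simp: f_def space_prob_algebra intro: prob_space.prob_le_1)
  have m_le: "m \<le> f z" if "z \<in> space X" for z
    unfolding m_def using f_range that by (intro cINF_lower bdd_belowI2[where m = 0]) auto
  have le_m: "f z \<le> exp a * m" if "z \<in> space X" for z
  proof -
    \<comment> \<open>By privacy of \<open>K\<close>, \<open>f z / exp a\<close> is a lower bound of
      all values of \<open>f\<close>.\<close>
    have "f z / exp a \<le> m"
      unfolding m_def using K A that ne
      by (intro cINF_greatest) (auto simp: f_def replacement_DP_local_randomizer_def field_simps)
    then show ?thesis by (simp add: field_simps)
  qed
  have p: "measure (bind (R x) K) A = p x" if "x \<in> space D" for x
  proof -
    interpret prob_space "R x" by (rule Rx) fact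
    show ?thesis
      unfolding p_def f_def using measurable_prob_algebraD[OF mK] A Rx(2)[OF that]
      by (intro measure_bind) (auto cong: measurable_cong_sets)
  qed
  have p_diff: "(\<integral>z. f z - m \<partial>R x) = p x - m" "(\<integral>z. exp a * m - f z \<partial>R x) = exp a * m - p x"
    if "x \<in> space D" for x
  proof -
    interpret prob_space "R x" by (rule Rx) fact
    have "f \<in> borel_measurable (R x)"
      using f_meas Rx(2)[OF that] by (simp cong: measurable_cong_sets)
    then have "integrable (R x) f"
      using f_range Rx(3)[OF that] by (intro integrable_const_bound[where B = 1]) auto
    then show "(\<integral>z. f z - m \<partial>R x) = p x - m" "(\<integral>z. exp a * m - f z \<partial>R x) = exp a * m - p x"
      by (simp_all add: p_def prob_space)
  qed
  have "(\<integral>z. f z - m \<partial>R x) \<le> exp b * (\<integral>z. f z - m \<partial>R x')"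
    using f_meas m_le f_range
    by (intro integral_le_if_replacement_DP[OF R x, where B = "1 - m"]) auto
  then have 1: "p x - m \<le> exp b * (p x' - m)"
    using x by (simp add: p_diff)
  \<comment> \<open>Here \<open>x\<close> and \<open>x'\<close> trade places: as \<open>f\<close>
    enters with a minus sign, this again bounds \<open>p x\<close> from above.\<close>
  have "(\<integral>z. exp a * m - f z \<partial>R x') \<le> exp b * (\<integral>z. exp a * m - f z \<partial>R x)"
    using f_meas le_m f_range
    by (intro integral_le_if_replacement_DP[OF R x(2) x(1), where B = "exp a * m"]) auto
  then have 2: "exp a * m - p x' \<le> exp b * (exp a * m - p x)"
    using x by (simp add: p_diff)
  \<comment> \<open>After this scaling, \<open>m\<close> has opposite coefficients in the two
    inequalities, so their sum no longer contains it.\<close>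
  have "exp a * (p x - m) \<le> exp a * (exp b * (p x' - m))"
    using 1 by (intro mult_left_mono) auto
  with 2 have "(exp b + exp a) * p x \<le> (exp b * exp a + 1) * p x'"
    by (simp add: algebra_simps)
  then have "p x \<le> (exp (b + a) + 1) / (exp b + exp a) * p x'"
    by (simp add: field_simps exp_add add_pos_pos)
  then show "measure (bind (R x) K) A
    \<le> exp (ln ((exp (b + a) + 1) / (exp b + exp a))) * measure (bind (R x') K) A"
    using x by (simp add: p add_pos_pos)
qed

section \<open>The bound on the ratio and the reduction of the algorithm to a composition\<close>

lemma replacement_DP_cong:
  assumes "\<And>x. x \<in> space D \<Longrightarrow> R x = R' x"
  shows "replacement_DP_local_randomizer D S \<epsilon> R \<longleftrightarrow> replacement_DP_local_randomizer D S \<epsilon> R'"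
  using assms by (simp add: replacement_DP_local_randomizer_def cong: measurable_cong)

text \<open>Clearing the denominator leaves \<open>1 \<le> exp b * exp b\<close>. Since the ratio is
  symmetric in \<open>a\<close> and \<open>b\<close>, this serves for both entries of the
  minimum.\<close>

lemma ln_ratio_le_left:
  fixes a b :: real
  assumes "0 \<le> b"
  shows "ln ((exp (b + a) + 1) / (exp b + exp a)) \<le> b"
proof -
  have "1 \<le> exp b * exp b"
    using assms by (simp flip: exp_add)
  then have "(exp (b + a) + 1) / (exp b + exp a) \<le> exp b"
    by (simp add: divide_le_eq add_pos_pos exp_add algebra_simps)
  then show ?thesis
    by (metis add_pos_pos divide_pos_pos exp_gt_zero ln_exp ln_mono zero_less_one)
qed

theorem mainTheorem3:
  fixes D :: "'a measure" and X :: "'b measure" and Y :: "'c measure"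
    and R\<^sub>b :: "'a \<Rightarrow> 'b measure" and R\<^sub>f :: "'b \<Rightarrow> 'c measure"
    and \<epsilon>\<^sub>b \<epsilon>\<^sub>f :: real and \<tau> t :: nat and J :: "nat set"
  assumes "\<epsilon>\<^sub>f > 0" and "\<epsilon>\<^sub>b > 0"
    and "replacement_DP_local_randomizer D X \<epsilon>\<^sub>b R\<^sub>b"
    and "replacement_DP_local_randomizer X Y \<epsilon>\<^sub>f R\<^sub>f"
    and "\<tau> \<ge> 1" and "J \<subseteq> {1..\<tau>}" and "card J = t"
  defines "\<epsilon> \<equiv> ln ((exp (\<epsilon>\<^sub>b + real t * \<epsilon>\<^sub>f) + 1) / (exp \<epsilon>\<^sub>b + exp (real t * \<epsilon>\<^sub>f)))"
  shows "replacement_DP_local_randomizer D (PiM J (\<lambda>_. Y)) \<epsilon> (M_alg R\<^sub>b R\<^sub>f Y \<tau> J)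
    \<and> \<epsilon> \<le> min \<epsilon>\<^sub>b (real t * \<epsilon>\<^sub>f)"
proof
  have mb: "R\<^sub>b \<in> D \<rightarrow>\<^sub>M prob_algebra X" and mf: "R\<^sub>f \<in> X \<rightarrow>\<^sub>M prob_algebra Y"
    using assms(3,4) by (simp_all add: replacement_DP_local_randomizer_def)
  have fin: "finite J"
    using assms(6) by (rule finite_subset) simp
  \<comment> \<open>For fixed \<open>z\<close> the outputs are independent, so dropping the
    coordinates outside \<open>J\<close> leaves the product over \<open>J\<close>; from here on
    \<tau> disappears.\<close>
  have marginal: "distr (PiM {1..\<tau>} (\<lambda>_. R\<^sub>f z)) (PiM J (\<lambda>_. Y)) (\<lambda>y. restrict y J)
    = PiM J (\<lambda>_. R\<^sub>f z)" if "z \<in> space X" for z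
  proof -
    have z: "prob_space (R\<^sub>f z)" "sets (R\<^sub>f z) = sets Y"
      using measurable_space[OF mf that] by (auto simp: space_prob_algebra)
    interpret z: prob_space "R\<^sub>f z" by fact
    interpret product_prob_space "\<lambda>_. R\<^sub>f z" "{1..\<tau>}"
      by unfold_locales
    have "PiM J (\<lambda>_. R\<^sub>f z)
      = distr (PiM {1..\<tau>} (\<lambda>_. R\<^sub>f z)) (PiM J (\<lambda>_. R\<^sub>f z)) (\<lambda>y. restrict y J)"
      using assms(6) by (intro distr_restrict) auto
    \<comment> \<open>Only the sigma-algebra of the target matters to \<open>distr\<close>, and
      \<open>R\<^sub>f z\<close> has the same one as \<open>Y\<close>.\<close>
    also have "\<dots> = distr (PiM {1..\<tau>} (\<lambda>_. R\<^sub>f z)) (PiM J (\<lambda>_. Y)) (\<lambda>y. restrict y J)"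
      using z by (intro distr_cong sets_PiM_cong) auto
    finally show ?thesis ..
  qed
  have "replacement_DP_local_randomizer D (PiM J (\<lambda>_. Y)) \<epsilon>
    (\<lambda>x. bind (R\<^sub>b x) (\<lambda>z. PiM J (\<lambda>_. R\<^sub>f z)))"
    unfolding \<epsilon>_def using assms(3) replacement_DP_PiM[OF assms(4) fin] assms(7)
    by (intro replacement_DP_bind) auto
  \<comment> \<open>The marginal identity holds on \<open>space X\<close>, which is the whole space
    of \<open>R\<^sub>b x\<close>.\<close>
  moreover have "M_alg R\<^sub>b R\<^sub>f Y \<tau> J x = bind (R\<^sub>b x) (\<lambda>z. PiM J (\<lambda>_. R\<^sub>f z))" if "x \<in> space D" for x
  proof -
    have "space (R\<^sub>b x) = space X"
      using measurable_space[OF mb that] by (auto simp: space_prob_algebra dest: sets_eq_imp_space_eq)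
    then show ?thesis
      unfolding M_alg_def by (intro bind_cong marginal) auto
  qed
  ultimately show "replacement_DP_local_randomizer D (PiM J (\<lambda>_. Y)) \<epsilon> (M_alg R\<^sub>b R\<^sub>f Y \<tau> J)"
    by (simp cong: replacement_DP_cong)
  show "\<epsilon> \<le> min \<epsilon>\<^sub>b (real t * \<epsilon>\<^sub>f)"
    \<comment> \<open>The second instance has the two privacy parameters swapped and bounds
      \<epsilon> by \<open>real t * \<epsilon>\<^sub>f\<close>.\<close>
    using ln_ratio_le_left[of \<epsilon>\<^sub>b "real t * \<epsilon>\<^sub>f"] ln_ratio_le_left[of "real t * \<epsilon>\<^sub>f" \<epsilon>\<^sub>b] assms(1,2)
    by (simp add: \<epsilon>_def add.commute)
qed

end
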